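(* Let $K\ge 1$ be fixed and, for each $n$, suppose the $n\times 1$ vector of excess returns satisfies $$\mathbf r_{t}=c\,\boldsymbol\tau_n+\mathbf B_n\boldsymbol\phi+\mathbf B_n\mathbf f_t+\boldsymbol\eta_n+\mathbf u_t ,$$ where $c$ is a scalar, $\boldsymbol\phi\in\mathbb R^K$ with $\boldsymbol\phi'\boldsymbol\phi>0$, $\mathbf f_t$ is the $K\times1$ vector of traded factors, $\mathbf B_n$ is an $n\times K$ matrix of (known) factor loadings with $\mathbf B_n'\mathbf M_n\mathbf B_n$ invertible, $\boldsymbol\eta_n$ is a given $n\times 1$ vector of pricing errors, and $\mathbf u_t$ is an $n\times1$ random vector with $E(\mathbf u_t)=\mathbf 0$ and $E(\mathbf u_t\mathbf u_t')=\mathbf V_u$. Define the portfolio weights $\mathbf w_\phi=\mathbf M_n\mathbf B_n(\mathbf B_n'\mathbf M_n\mathbf B_n)^{-1}\boldsymbol\phi$ and the hedged (phi-)portfolio return $\rho_{t,\phi}=\mathbf w_\phi'\mathbf r_t-\boldsymbol\phi'\mathbf f_t$. Then $$\rho_{t,\phi}=\boldsymbol\phi'\boldsymbol\phi+\mathbf w_\phi'\boldsymbol\eta_n+\mathbf w_\phi'\mathbf u_t,$$ $$\left|\mathbf w_\phi'\boldsymbol\eta_n\right|^2\le\frac{\|\boldsymbol\eta_n\|^2\|\boldsymbol\phi\|^2}{\lambda_{\min}(\mathbf B_n'\mathbf M_n\mathbf B_n)},\qquad Var(\rho_{t,\phi})\le\frac{\lambda_{\max}(\mathbf V_u)\|\boldsymbol\phi\|^2}{\lambda_{\min}(\mathbf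 B_n'\mathbf M_n\mathbf B_n)} .$$ Consequently, if as $n\to\infty$ $$\frac{\|\boldsymbol\eta_n\|^2}{\lambda_{\min}(\mathbf B_n'\mathbf M_n\mathbf B_n)}\to0\quad\text{and}\quad\frac{\lambda_{\max}(\mathbf V_u)}{\lambda_{\min}(\mathbf B_n'\mathbf M_n\mathbf B_n)}\to0,$$ then $E(\rho_{t,\phi})\to\boldsymbol\phi'\boldsymbol\phi$ and $Var(\rho_{t,\phi})\to0$ as $n\to\infty$.
   Context: $\boldsymbol\tau_n$ is the $n\times1$ vector of ones, $\mathbf M_n=\mathbf I_n-n^{-1}\boldsymbol\tau_n\boldsymbol\tau_n'$. $\lambda_{\min}(\cdot),\lambda_{\max}(\cdot)$ denote the smallest and largest eigenvalues of a symmetric matrix, and $\|\cdot\|$ is the Euclidean norm of a vector. $\mathbf B_n$, $\boldsymbol\phi$, $\boldsymbol\eta_n$ are treated as non-random; $\boldsymbol\phi$ and $K$ do not depend on $n$. *)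

theory Defs
  imports
    "HOL-Probability.Probability"
    "Jordan_Normal_Form.Gauss_Jordan_Elimination"
    "Jordan_Normal_Form.Spectral_Radius"
begin

(* The cross-sectional dimension n tends to infinity, so vectors and matrices are those of
   Jordan_Normal_Form, with n as a term. The clashing HOL-Analysis notation is switched off. *)
unbundle no vec_syntax and no inner_syntax

type_synonym rvec = "real Matrix.vec"
type_synonym rmat = "real Matrix.mat"

definition ones_vec :: "nat \<Rightarrow> rvec" where
  "ones_vec n = Matrix.vec n (\<lambda>_. 1)"

definition outer_prod :: "rvec \<Rightarrow> rvec \<Rightarrow> rmat" where
  "outer_prod v w = Matrix.mat (dim_vec v) (dim_vec w) (\<lambda>(i, j). v $ i * w $ j)"

definition centering_mat :: "nat \<Rightarrow> rmat" where
  "centering_mat n = 1\<^sub>m n - (1 / real n) \<cdot>\<^sub>m outer_prod (ones_vec n) (ones_vec n)"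

definition vnorm :: "rvec \<Rightarrow> real" where
  "vnorm v = sqrt (v \<bullet> v)"

(* Used only for real symmetric matrices of positive dimension: all eigenvalues are then real,
   and the spectrum is finite and nonempty. *)
definition lambda_min :: "rmat \<Rightarrow> real" where
  "lambda_min A = Min (spectrum A)"

definition lambda_max :: "rmat \<Rightarrow> real" where
  "lambda_max A = Max (spectrum A)"

(* Meaningful only if A is invertible; mat_inverse returns None otherwise. *)
definition mat_inv :: "rmat \<Rightarrow> rmat" where
  "mat_inv A = the (mat_inverse A)"

definition BMB :: "nat \<Rightarrow> rmat \<Rightarrow> rmat" where
  "BMB n B = transpose_mat B * centering_mat n * B"

definition w_phi :: "nat \<Rightarrow> rmat \<Rightarrow> rvec \<Rightarrow> rvec" where
  "w_phi n B \<phi> = (centering_mat n * B * mat_inv (BMB n B)) *\<^sub>v \<phi>"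

definition rho_phi ::
    "nat \<Rightarrow> rmat \<Rightarrow> rvec \<Rightarrow> ('w \<Rightarrow> rvec) \<Rightarrow> ('w \<Rightarrow> rvec) \<Rightarrow> 'w \<Rightarrow> real" where
  "rho_phi n B \<phi> r f \<omega> = w_phi n B \<phi> \<bullet> r \<omega> - \<phi> \<bullet> f \<omega>"

definition random_vec :: "'w measure \<Rightarrow> nat \<Rightarrow> ('w \<Rightarrow> rvec) \<Rightarrow> bool" where
  "random_vec M n X \<longleftrightarrow>
     (\<forall>\<omega>\<in>space M. X \<omega> \<in> carrier_vec n) \<and> (\<forall>i<n. (\<lambda>\<omega>. X \<omega> $ i) \<in> borel_measurable M)"

(* E(X) = m and E(Y) = A, entrywise, including the existence of the expectations. *)
definition has_expectation_vec :: "'w measure \<Rightarrow> nat \<Rightarrow> ('w \<Rightarrow> rvec) \<Rightarrow> rvec \<Rightarrow> bool" where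
  "has_expectation_vec M n X m \<longleftrightarrow>
     m \<in> carrier_vec n \<and>
     (\<forall>i<n. integrable M (\<lambda>\<omega>. X \<omega> $ i) \<and> prob_space.expectation M (\<lambda>\<omega>. X \<omega> $ i) = m $ i)"

definition has_expectation_mat ::
    "'w measure \<Rightarrow> nat \<Rightarrow> nat \<Rightarrow> ('w \<Rightarrow> rmat) \<Rightarrow> rmat \<Rightarrow> bool" where
  "has_expectation_mat M n m Y A \<longleftrightarrow>
     A \<in> carrier_mat n m \<and>
     (\<forall>i<n. \<forall>j<m. integrable M (\<lambda>\<omega>. Y \<omega> $$ (i, j)) \<and>
        prob_space.expectation M (\<lambda>\<omega>. Y \<omega> $$ (i, j)) = A $$ (i, j))"

(* The return equation for n assets at one date. Invertibility of B' M B forces n > K, so with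
   K \<ge> 1 the model cannot hold for small n. *)
definition return_model ::
    "'w measure \<Rightarrow> nat \<Rightarrow> nat \<Rightarrow> real \<Rightarrow> rvec \<Rightarrow> ('w \<Rightarrow> rvec) \<Rightarrow> rmat \<Rightarrow> rvec \<Rightarrow>
      ('w \<Rightarrow> rvec) \<Rightarrow> rmat \<Rightarrow> ('w \<Rightarrow> rvec) \<Rightarrow> bool" where
  "return_model M n K c \<phi> f B \<eta> u V r \<longleftrightarrow>
     B \<in> carrier_mat n K \<and> invertible_mat (BMB n B) \<and>
     \<eta> \<in> carrier_vec n \<and>
     random_vec M n u \<and>
     has_expectation_vec M n u (0\<^sub>v n) \<and>
     has_expectation_mat M n n (\<lambda>\<omega>. outer_prod (u \<omega>) (u \<omega>)) V \<and>
     (\<forall>\<omega>\<in>space M.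
        r \<omega> = c \<cdot>\<^sub>v ones_vec n + B *\<^sub>v \<phi> + B *\<^sub>v f \<omega> + \<eta> + u \<omega>)"

end

(* The weights w = M B (B'MB)^{-1} phi annihilate the constant vector and satisfy
   w'B x = phi'x, so r collapses to phi'phi + phi'f + w'eta + w'u. With y = (B'MB)^{-1} phi one has
   w'w = phi'y and lambda_min y'y <= y'(B'MB)y = phi'y, whence w'w <= phi'phi / lambda_min by
   Cauchy-Schwarz; both bounds follow.
   The only spectral input is lambda_min x'x <= x'Ax for symmetric A. Let k be the largest number with
   k x'x <= x'Ax for all x. Were A - kI invertible, Cauchy-Schwarz for the semidefinite form A - kI
   would give x'(A - kI)x >= e x'x for some e > 0, contradicting maximality; so k is an eigenvalue. *)
theory Submission
  imports Defs
begin

section \<open>Symmetric matrices and Cauchy-Schwarz inequalities\<close>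

definition real_symmetric_mat :: "nat \<Rightarrow> rmat \<Rightarrow> bool" where
  "real_symmetric_mat n A \<longleftrightarrow> A \<in> carrier_mat n n \<and> transpose_mat A = A"

lemma scalar_prod_mult_symmetric:
  assumes "real_symmetric_mat n A" "x \<in> carrier_vec n" "y \<in> carrier_vec n"
  shows "(A *\<^sub>v x) \<bullet> y = x \<bullet> (A *\<^sub>v y)"
  using assms transpose_vec_mult_scalar[of A n n y x] unfolding real_symmetric_mat_def by simp

lemma scalar_prod_self_nonneg: "0 \<le> (x :: rvec) \<bullet> x"
  unfolding scalar_prod_def by (intro sum_nonneg) auto

lemma scalar_prod_self_pos:
  assumes "(x :: rvec) \<in> carrier_vec n" "x \<noteq> 0\<^sub>v n"
  shows "0 < x \<bullet> x"
proof -
  have "x \<bullet> x \<noteq> 0"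
  proof
    assume "x \<bullet> x = 0"
    then have "\<forall>i\<in>{0..<n}. x $ i * x $ i = 0"
      using assms(1) unfolding scalar_prod_def by (subst (asm) sum_nonneg_eq_0_iff) auto
    then have "x = 0\<^sub>v n" using assms(1) by (intro eq_vecI) auto
    then show False using assms(2) by simp
  qed
  with scalar_prod_self_nonneg[of x] show ?thesis by linarith
qed

lemma vnorm_square: "(vnorm v)\<^sup>2 = v \<bullet> v"
  unfolding vnorm_def using scalar_prod_self_nonneg[of v] by simp

text \<open>A real quadratic that never becomes negative has nonpositive discriminant. The case c =
  0 is included because the forms it serves are only semidefinite and may vanish at a nonzero
  vector.\<close>

lemma quadratic_nonneg_discriminant:
  fixes a b c :: real
  assumes "\<And>s. 0 \<le> a + 2 * s * b + s\<^sup>2 * c" and "0 \<le> c"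
  shows "b\<^sup>2 \<le> a * c"
proof (cases "c = 0")
  case True
  have "b = 0"
  proof (rule ccontr)
    assume "b \<noteq> 0"
    \<comment> \<open>At this \<open>s\<close> the remaining linear function takes the value
      -1.\<close>
    then show False using assms(1)[of "- (a + 1) / (2 * b)"] True by (simp add: field_simps)
  qed
  then show ?thesis using True by simp
next
  case False
  then have "c > 0" using assms(2) by simp
  \<comment> \<open>The point -b/c is the minimiser; the value there is a - b^2/c.\<close>
  then show ?thesis using assms(1)[of "- b / c"]
    by (simp add: field_simps power2_eq_square)
qed

text \<open>The form evaluated at x + s y is a nonnegative quadratic in s, and the claim is its
  discriminant inequality. It serves twice: with the identity matrix for ordinary vectors, and with
  A - kI in the eigenvalue argument.\<close>

lemma form_Cauchy_Schwarz:
  assumes A: "real_symmetric_mat n A"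
    and psd: "\<And>x. x \<in> carrier_vec n \<Longrightarrow> 0 \<le> x \<bullet> (A *\<^sub>v x)"
    and x: "x \<in> carrier_vec n" and y: "y \<in> carrier_vec n"
  shows "(x \<bullet> (A *\<^sub>v y))\<^sup>2 \<le> (x \<bullet> (A *\<^sub>v x)) * (y \<bullet> (A *\<^sub>v y))"
proof (rule quadratic_nonneg_discriminant)
  have AC: "A \<in> carrier_mat n n" using A unfolding real_symmetric_mat_def by simp
  note c = mult_mat_vec_carrier[OF AC x] mult_mat_vec_carrier[OF AC y]
  show "0 \<le> y \<bullet> (A *\<^sub>v y)" using psd y .
  fix s :: real
  have sy: "s \<cdot>\<^sub>v y \<in> carrier_vec n" using y by simp
  \<comment> \<open>Symmetry makes the two cross terms equal, which produces the coefficient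
    2s.\<close>
  have yx: "y \<bullet> (A *\<^sub>v x) = x \<bullet> (A *\<^sub>v y)"
    using scalar_prod_mult_symmetric[OF A x y] comm_scalar_prod[OF y c(1)] by simp
  have Axy: "A *\<^sub>v (x + s \<cdot>\<^sub>v y) = A *\<^sub>v x + s \<cdot>\<^sub>v (A *\<^sub>v y)"
    using mult_add_distrib_mat_vec[OF AC x sy] mult_mat_vec[OF AC y] by simp
  have "0 \<le> (x + s \<cdot>\<^sub>v y) \<bullet> (A *\<^sub>v (x + s \<cdot>\<^sub>v y))"
    by (rule psd) (use x y in simp)
  also have "\<dots> = x \<bullet> (A *\<^sub>v x) + 2 * s * (x \<bullet> (A *\<^sub>v y)) + s\<^sup>2 * (y \<bullet> (A *\<^sub>v y))"
    unfolding Axy using x y c yx sy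
    by (simp add: add_scalar_prod_distrib[of _ n] scalar_prod_add_distrib[of _ n]
        power2_eq_square algebra_simps)
  finally show "0 \<le> x \<bullet> (A *\<^sub>v x) + 2 * s * (x \<bullet> (A *\<^sub>v y)) + s\<^sup>2 * (y \<bullet> (A *\<^sub>v y))" .
qed

lemma vec_Cauchy_Schwarz:
  assumes "(x :: rvec) \<in> carrier_vec n" "y \<in> carrier_vec n"
  shows "(x \<bullet> y)\<^sup>2 \<le> (x \<bullet> x) * (y \<bullet> y)"
  using form_Cauchy_Schwarz[of n "1\<^sub>m n" x y] assms scalar_prod_self_nonneg
  unfolding real_symmetric_mat_def by simp

section \<open>Extreme eigenvalues as bounds on quadratic forms\<close>

lemma quadratic_form_bounded:
  assumes A: "A \<in> carrier_mat n n"
  obtains b :: real where "0 < b" "\<And>x. x \<in> carrier_vec n \<Longrightarrow> \<bar>x \<bullet> (A *\<^sub>v x)\<bar> \<le> b * (x \<bullet> x)"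
proof
  \<comment> \<open>Each product of two coordinates is at most x'x in absolute value, so the sum of
    the absolute entries is a bound. The added 1 keeps it positive for the zero matrix, since 1/b is
    formed later.\<close>
  let ?b = "1 + (\<Sum>i = 0..<n. \<Sum>j = 0..<n. \<bar>A $$ (i, j)\<bar>)"
  show "0 < ?b" by (smt (verit) sum_nonneg abs_ge_zero)
  fix x :: rvec assume x: "x \<in> carrier_vec n"
  have sq: "x $ i * x $ i \<le> x \<bullet> x" if "i < n" for i
    unfolding scalar_prod_def using x that
    by (intro member_le_sum) auto
  have xx: "\<bar>x $ i * x $ j\<bar> \<le> x \<bullet> x" if "i < n" "j < n" for i j
  proof -
    have "2 * \<bar>x $ i * x $ j\<bar> \<le> x $ i * x $ i + x $ j * x $ j"
      using sum_squares_bound[of "\<bar>x $ i\<bar>" "\<bar>x $ j\<bar>"] by (simp add: power2_eq_square abs_mult)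
    then show ?thesis using sq[OF that(1)] sq[OF that(2)] by linarith
  qed
  have "x \<bullet> (A *\<^sub>v x) = (\<Sum>i = 0..<n. \<Sum>j = 0..<n. A $$ (i, j) * (x $ i * x $ j))"
    unfolding scalar_prod_def using A x
    by (auto simp: scalar_prod_def sum_distrib_left mult_ac intro!: sum.cong)
  also have "\<bar>\<dots>\<bar> \<le> (\<Sum>i = 0..<n. \<Sum>j = 0..<n. \<bar>A $$ (i, j)\<bar> * (x \<bullet> x))"
    by (intro order_trans[OF sum_abs] sum_mono) (auto simp: abs_mult[of "A $$ _"] intro!: mult_left_mono xx)
  also have "\<dots> \<le> ?b * (x \<bullet> x)"
    using scalar_prod_self_nonneg[of x] by (simp add: sum_distrib_right distrib_right)
  finally show "\<bar>x \<bullet> (A *\<^sub>v x)\<bar> \<le> ?b * (x \<bullet> x)" .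
qed

text \<open>\<open>char_matrix A k\<close> is encoded as the sum of A and (-k)I; this gives its
  action in the form Ax - kx.\<close>

lemma char_matrix_mult_vec:
  fixes A :: rmat
  assumes A: "A \<in> carrier_mat n n" and x: "x \<in> carrier_vec n"
  shows "char_matrix A k *\<^sub>v x = A *\<^sub>v x - k \<cdot>\<^sub>v x"
proof -
  have s: "((- k) \<cdot>\<^sub>m 1\<^sub>m n) *\<^sub>v x = (- k) \<cdot>\<^sub>v x"
    using x by (intro eq_vecI) auto
  have "char_matrix A k *\<^sub>v x = A *\<^sub>v x + ((- k) \<cdot>\<^sub>m 1\<^sub>m n) *\<^sub>v x"
    unfolding char_matrix_def using A x by (simp add: add_mult_distrib_mat_vec[of _ n n])
  then show ?thesis unfolding s using A x by (intro eq_vecI) auto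
qed

text \<open>With D the inverse of C, Cauchy-Schwarz for the form of C at x and Dx gives (x'x)^2 <=
  (x'Cx)(x'Dx). The last factor is at most b x'x, so cancelling x'x leaves the constant e =
  1/b.\<close>

lemma psd_invertible_coercive:
  assumes C: "real_symmetric_mat n C"
    and psd: "\<And>x. x \<in> carrier_vec n \<Longrightarrow> 0 \<le> x \<bullet> (C *\<^sub>v x)"
    and det: "det C \<noteq> 0"
  obtains e :: real where "0 < e" "\<And>x. x \<in> carrier_vec n \<Longrightarrow> e * (x \<bullet> x) \<le> x \<bullet> (C *\<^sub>v x)"
proof -
  have CC: "C \<in> carrier_mat n n" using C unfolding real_symmetric_mat_def by simp
  obtain D where D: "D \<in> carrier_mat n n" and CD: "C * D = 1\<^sub>m n"
    using det_non_zero_imp_unit[OF CC det, of "()"] unfolding Units_def ring_mat_def by auto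
  obtain b where b: "0 < b" "\<And>x. x \<in> carrier_vec n \<Longrightarrow> \<bar>x \<bullet> (D *\<^sub>v x)\<bar> \<le> b * (x \<bullet> x)"
    using quadratic_form_bounded[OF D] by blast
  have "(1 / b) * (x \<bullet> x) \<le> x \<bullet> (C *\<^sub>v x)" if x: "x \<in> carrier_vec n" for x
  proof (cases "x \<bullet> x = 0")
    case True
    then show ?thesis using psd[OF x] by simp
  next
    case False
    then have pos: "0 < x \<bullet> x" using scalar_prod_self_nonneg[of x] by simp
    have Dx: "D *\<^sub>v x \<in> carrier_vec n" using D x by simp
    have CDx: "C *\<^sub>v (D *\<^sub>v x) = x"
      using assoc_mult_mat_vec[OF CC D x] CD x by simp
    \<comment> \<open>The choice y = Dx turns x'Cy into x'x and y'Cy into (Dx)'x.\<close>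
    have "(x \<bullet> x)\<^sup>2 \<le> (x \<bullet> (C *\<^sub>v x)) * ((D *\<^sub>v x) \<bullet> x)"
      using form_Cauchy_Schwarz[OF C psd x Dx] CDx by simp
    also have "(D *\<^sub>v x) \<bullet> x = x \<bullet> (D *\<^sub>v x)" using comm_scalar_prod[OF Dx x] .
    also have "(x \<bullet> (C *\<^sub>v x)) * (x \<bullet> (D *\<^sub>v x)) \<le> (x \<bullet> (C *\<^sub>v x)) * (b * (x \<bullet> x))"
      using b(2)[OF x] by (intro mult_left_mono psd x) auto
    finally have "(x \<bullet> x) * (x \<bullet> x) \<le> (b * (x \<bullet> (C *\<^sub>v x))) * (x \<bullet> x)"
      by (simp add: power2_eq_square mult_ac)
    then have "x \<bullet> x \<le> b * (x \<bullet> (C *\<^sub>v x))" using pos by simp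
    then show ?thesis using b(1) by (simp add: field_simps)
  qed
  then show thesis using that[of "1 / b"] b(1) by simp
qed

lemma symmetric_char_matrix:
  assumes "real_symmetric_mat n A"
  shows "real_symmetric_mat n (char_matrix A k)"
proof -
  have A: "A \<in> carrier_mat n n" and t: "transpose_mat A = A"
    using assms unfolding real_symmetric_mat_def by auto
  have "A $$ (j, i) = A $$ (i, j)" if "i < n" "j < n" for i j
    using A that arg_cong[OF t, of "\<lambda>X. X $$ (i, j)"] by simp
  then show ?thesis unfolding real_symmetric_mat_def char_matrix_def using A
    by (auto intro!: eq_matI)
qed

text \<open>A supremum of lower bounds replaces the usual minimisation over the compact unit sphere,
  so no minimising vector has to be found; the eigenvalue comes from a vanishing
  determinant.\<close>

lemma symmetric_Rayleigh_eigenvalue: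
  assumes S: "real_symmetric_mat n A" and n: "0 < n"
  obtains k where "eigenvalue A k" "\<And>x. x \<in> carrier_vec n \<Longrightarrow> k * (x \<bullet> x) \<le> x \<bullet> (A *\<^sub>v x)"
proof -
  have A: "A \<in> carrier_mat n n" using S unfolding real_symmetric_mat_def by simp
  obtain b where b: "0 < b" "\<And>x. x \<in> carrier_vec n \<Longrightarrow> \<bar>x \<bullet> (A *\<^sub>v x)\<bar> \<le> b * (x \<bullet> x)"
    using quadratic_form_bounded[OF A] by blast
  define L where "L = {m. \<forall>x\<in>carrier_vec n. m * (x \<bullet> x) \<le> x \<bullet> (A *\<^sub>v x)}"
  have "- b \<in> L" unfolding L_def using b(2) by (auto simp: abs_le_iff minus_le_iff)
  then have ne: "L \<noteq> {}" by blast
  have le: "m \<le> (x \<bullet> (A *\<^sub>v x)) / (x \<bullet> x)" if "m \<in> L" "x \<in> carrier_vec n" "0 < x \<bullet> x" for m x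
    using that unfolding L_def by (simp add: field_simps)
  \<comment> \<open>The Rayleigh quotient at one unit vector bounds \<open>L\<close> from above.
    Positive dimension matters here: for n = 0 every real number belongs to
    \<open>L\<close>.\<close>
  have unit: "unit_vec n 0 \<bullet> unit_vec n 0 = (1::real)" using n by simp
  have bdd: "bdd_above L"
    using le[of _ "unit_vec n 0"] unit by (intro bdd_aboveI) auto
  define k where "k = Sup L"
  \<comment> \<open>The supremum itself lies in \<open>L\<close>: for each fixed nonzero x the
    quotient bounds all members of \<open>L\<close>, hence also their supremum.\<close>
  have kL: "k * (x \<bullet> x) \<le> x \<bullet> (A *\<^sub>v x)" if x: "x \<in> carrier_vec n" for x
  proof (cases "x \<bullet> x = 0")
    case True
    then show ?thesis using b(2)[OF x] by simp
  next
    case False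
    then have pos: "0 < x \<bullet> x" using scalar_prod_self_nonneg[of x] by simp
    have "k \<le> (x \<bullet> (A *\<^sub>v x)) / (x \<bullet> x)"
      unfolding k_def using ne le x pos by (intro cSup_least) auto
    then show ?thesis using pos by (simp add: field_simps)
  qed
  have form: "x \<bullet> (char_matrix A k *\<^sub>v x) = x \<bullet> (A *\<^sub>v x) - k * (x \<bullet> x)"
    if x: "x \<in> carrier_vec n" for x
    unfolding char_matrix_mult_vec[OF A x] using A x
    by (simp add: scalar_prod_minus_distrib[of _ n])
  have "det (char_matrix A k) = 0"
  proof (rule ccontr)
    assume "det (char_matrix A k) \<noteq> 0"
    then obtain e where e: "0 < e"
      "\<And>x. x \<in> carrier_vec n \<Longrightarrow> e * (x \<bullet> x) \<le> x \<bullet> (char_matrix A k *\<^sub>v x)"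
      using psd_invertible_coercive[OF symmetric_char_matrix[OF S]] form kL
      by (metis diff_ge_0_iff_ge)
    have "k + e \<in> L" unfolding L_def using e(2) form by (auto simp: algebra_simps)
    then have "k + e \<le> k" unfolding k_def using bdd by (rule cSup_upper)
    then show False using e(1) by simp
  qed
  then have "eigenvalue A k" using eigenvalue_det[OF A] by simp
  then show thesis using that kL by blast
qed

text \<open>\<open>Min\<close> is meaningful only on a finite nonempty set. The real spectrum of a
  general real matrix may be empty; here the Rayleigh eigenvalue shows that it is not.\<close>

lemma lambda_min_in_spectrum:
  assumes "real_symmetric_mat n A" "0 < n"
  shows "lambda_min A \<in> spectrum A"
proof -
  obtain k where "eigenvalue A k" using symmetric_Rayleigh_eigenvalue[OF assms] by blast
  then show ?thesis unfolding lambda_min_def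
    using card_finite_spectrum(1)[of A n] assms(1)
    by (intro Min_in) (auto simp: spectrum_def real_symmetric_mat_def)
qed

text \<open>The Rayleigh constant k is an eigenvalue, so \<open>lambda_min A\<close> is at most k,
  and x'x is nonnegative.\<close>

lemma lambda_min_le_form:
  assumes "real_symmetric_mat n A" "0 < n" "x \<in> carrier_vec n"
  shows "lambda_min A * (x \<bullet> x) \<le> x \<bullet> (A *\<^sub>v x)"
proof -
  obtain k where k: "eigenvalue A k" "k * (x \<bullet> x) \<le> x \<bullet> (A *\<^sub>v x)"
    using symmetric_Rayleigh_eigenvalue[OF assms(1,2)] assms(3) by blast
  have "lambda_min A \<le> k" unfolding lambda_min_def
    using card_finite_spectrum(1)[of A n] assms(1) k(1)
    by (intro Min_le) (auto simp: spectrum_def real_symmetric_mat_def)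
  then have "lambda_min A * (x \<bullet> x) \<le> k * (x \<bullet> x)"
    by (intro mult_right_mono scalar_prod_self_nonneg)
  with k(2) show ?thesis by linarith
qed

text \<open>The Rayleigh lemma is applied to -A. If k is the eigenvalue found there, then -k is an
  eigenvalue of A with the same eigenvector, hence at most \<open>lambda_max A\<close>, and -k
  bounds the form of A from above.\<close>

lemma form_le_lambda_max:
  assumes S: "real_symmetric_mat n A" and n: "0 < n" and x: "x \<in> carrier_vec n"
  shows "x \<bullet> (A *\<^sub>v x) \<le> lambda_max A * (x \<bullet> x)"
proof -
  have A: "A \<in> carrier_mat n n" using S unfolding real_symmetric_mat_def by simp
  have neg: "(- A) *\<^sub>v v = - (A *\<^sub>v v)" if "v \<in> carrier_vec n" for v
    using A that by (intro eq_vecI) auto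
  have "real_symmetric_mat n (- A)"
    using S transpose_uminus[of A] unfolding real_symmetric_mat_def by auto
  then obtain k where k: "eigenvalue (- A) k"
    "\<And>x. x \<in> carrier_vec n \<Longrightarrow> k * (x \<bullet> x) \<le> x \<bullet> ((- A) *\<^sub>v x)"
    using symmetric_Rayleigh_eigenvalue n by blast
  have xk: "x \<bullet> (A *\<^sub>v x) \<le> (- k) * (x \<bullet> x)"
    using k(2)[OF x] neg[OF x] A x by simp
  from k(1) obtain v where v: "v \<in> carrier_vec n" "v \<noteq> 0\<^sub>v n" "(- A) *\<^sub>v v = k \<cdot>\<^sub>v v"
    using A unfolding eigenvalue_def eigenvector_def by auto
  have "A *\<^sub>v v = (- k) \<cdot>\<^sub>v v"
  proof (intro eq_vecI)
    fix i assume "i < dim_vec ((- k) \<cdot>\<^sub>v v)"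
    then show "(A *\<^sub>v v) $ i = ((- k) \<cdot>\<^sub>v v) $ i"
      using arg_cong[OF v(3), of "\<lambda>w. w $ i"] neg[OF v(1)] v(1) A by simp
  qed (use A v in simp)
  then have "- k \<in> spectrum A" unfolding spectrum_def eigenvalue_def eigenvector_def
    using v A by auto
  then have "- k \<le> lambda_max A" unfolding lambda_max_def
    using card_finite_spectrum(1)[OF A] by (intro Max_ge) auto
  then have "(- k) * (x \<bullet> x) \<le> lambda_max A * (x \<bullet> x)"
    by (intro mult_right_mono scalar_prod_self_nonneg)
  with xk show ?thesis by linarith
qed

section \<open>The centering matrix as a symmetric projection\<close>

lemma centering_mat_carrier: "centering_mat n \<in> carrier_mat n n"
  unfolding centering_mat_def outer_prod_def ones_vec_def by (intro carrier_matI) simp_all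

lemma centering_mat_symmetric: "real_symmetric_mat n (centering_mat n)"
  unfolding real_symmetric_mat_def
  by (auto simp: centering_mat_def outer_prod_def ones_vec_def intro!: eq_matI)

text \<open>Centering subtracts the mean from every entry. In this coordinate form, annihilation of
  constants and idempotence reduce to sums of entries.\<close>

lemma centering_mult_vec:
  assumes x: "x \<in> carrier_vec n"
  shows "centering_mat n *\<^sub>v x = Matrix.vec n (\<lambda>i. x $ i - (\<Sum>j = 0..<n. x $ j) / real n)"
proof (rule eq_vecI)
  fix i assume "i < dim_vec (Matrix.vec n (\<lambda>i. x $ i - (\<Sum>j = 0..<n. x $ j) / real n))"
  then have i: "i < n" by simp
  have "(centering_mat n *\<^sub>v x) $ i
      = (\<Sum>j = 0..<n. ((if i = j then 1 else 0) - 1 / real n) * x $ j)"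
    using i x centering_mat_carrier[of n]
    by (auto simp: scalar_prod_def centering_mat_def outer_prod_def ones_vec_def intro!: sum.cong)
  also have "\<dots> = (\<Sum>j = 0..<n. (if i = j then x $ j else 0) - x $ j / real n)"
    by (intro sum.cong) (auto simp: algebra_simps)
  also have "\<dots> = x $ i - (\<Sum>j = 0..<n. x $ j) / real n"
    using i by (simp add: sum_subtractf sum_divide_distrib)
  finally show "(centering_mat n *\<^sub>v x) $ i
      = Matrix.vec n (\<lambda>i. x $ i - (\<Sum>j = 0..<n. x $ j) / real n) $ i"
    using i by simp
qed (use centering_mat_carrier[of n] in simp)

lemma centering_mult_ones: "centering_mat n *\<^sub>v ones_vec n = 0\<^sub>v n"
  by (subst centering_mult_vec) (auto simp: ones_vec_def intro!: eq_vecI)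

text \<open>The entries of a centered vector sum to zero, so a second centering subtracts
  nothing.\<close>

lemma centering_idempotent:
  assumes x: "x \<in> carrier_vec n"
  shows "centering_mat n *\<^sub>v (centering_mat n *\<^sub>v x) = centering_mat n *\<^sub>v x"
\<comment> \<open>The cancellation of n against 1/n in the sum of entries requires n to be
  nonzero.\<close>
proof (cases "n = 0")
  case True
  then show ?thesis using centering_mat_carrier[of n] x by (intro eq_vecI) auto
next
  case False
  let ?y = "centering_mat n *\<^sub>v x"
  have y: "?y \<in> carrier_vec n" using mult_mat_vec_carrier[OF centering_mat_carrier x] .
  have "(\<Sum>j = 0..<n. ?y $ j) = 0"
    unfolding centering_mult_vec[OF x] using False by (simp add: sum_subtractf)
  then have "centering_mat n *\<^sub>v ?y = Matrix.vec n (($) ?y)"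
    unfolding centering_mult_vec[OF y] by simp
  also have "\<dots> = ?y"
    by (rule eq_vecI) (use y in \<open>simp_all del: index_mult_mat_vec dim_mult_mat_vec\<close>)
  finally show ?thesis .
qed

section \<open>The Gram matrix of the centered loadings\<close>

lemma BMB_carrier: "B \<in> carrier_mat n K \<Longrightarrow> BMB n B \<in> carrier_mat K K"
  unfolding BMB_def by (intro carrier_matI) simp_all

lemma BMB_mult_vec:
  assumes "B \<in> carrier_mat n K" "x \<in> carrier_vec K"
  shows "BMB n B *\<^sub>v x = transpose_mat B *\<^sub>v (centering_mat n *\<^sub>v (B *\<^sub>v x))"
  unfolding BMB_def using assms centering_mat_carrier[of n]
  by (simp add: assoc_mult_mat_vec[of _ K n _ K] assoc_mult_mat_vec[of _ K n _ n])

lemma BMB_symmetric: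
  assumes B: "B \<in> carrier_mat n K"
  shows "real_symmetric_mat K (BMB n B)"
proof -
  let ?M = "centering_mat n"
  note M = centering_mat_carrier[of n]
  have Bt: "transpose_mat B \<in> carrier_mat K n" using B by simp
  have "transpose_mat (transpose_mat B * ?M * B) = transpose_mat B * transpose_mat (transpose_mat B * ?M)"
    by (rule transpose_mult[OF mult_carrier_mat[OF Bt M] B])
  also have "transpose_mat (transpose_mat B * ?M) = transpose_mat ?M * B"
    using transpose_mult[OF Bt M] by simp
  also have "transpose_mat ?M = ?M"
    using centering_mat_symmetric unfolding real_symmetric_mat_def by simp
  also have "transpose_mat B * (?M * B) = transpose_mat B * ?M * B"
    by (rule assoc_mult_mat[OF Bt M B, symmetric])
  finally show ?thesis
    unfolding real_symmetric_mat_def using BMB_carrier[OF B] unfolding BMB_def by simp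
qed

text \<open>Moves B' across the scalar product. Semidefiniteness of B'MB and the loadings of the
  portfolio are both read off from this identity.\<close>

lemma BMB_form:
  assumes B: "B \<in> carrier_mat n K" and x: "x \<in> carrier_vec K" and y: "y \<in> carrier_vec K"
  shows "(BMB n B *\<^sub>v x) \<bullet> y = (centering_mat n *\<^sub>v (B *\<^sub>v x)) \<bullet> (B *\<^sub>v y)"
  unfolding BMB_mult_vec[OF B x]
  by (rule transpose_vec_mult_scalar[OF B y])
    (use B x centering_mat_carrier[of n] in simp)

text \<open>Since M is symmetric and idempotent, x'B'MBx is the squared norm of MBx.\<close>

lemma BMB_psd:
  assumes B: "B \<in> carrier_mat n K" and x: "x \<in> carrier_vec K"
  shows "0 \<le> x \<bullet> (BMB n B *\<^sub>v x)"
proof -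
  have Bx: "B *\<^sub>v x \<in> carrier_vec n" using B x by simp
  have MBx: "centering_mat n *\<^sub>v (B *\<^sub>v x) \<in> carrier_vec n"
    using Bx centering_mat_carrier[of n] by simp
  have "x \<bullet> (BMB n B *\<^sub>v x) = (BMB n B *\<^sub>v x) \<bullet> x"
    using x B BMB_carrier[OF B] by (intro comm_scalar_prod[of _ K]) auto
  also have "\<dots> = (centering_mat n *\<^sub>v (centering_mat n *\<^sub>v (B *\<^sub>v x))) \<bullet> (B *\<^sub>v x)"
    unfolding BMB_form[OF B x x] centering_idempotent[OF Bx] ..
  also have "\<dots> = (centering_mat n *\<^sub>v (B *\<^sub>v x)) \<bullet> (centering_mat n *\<^sub>v (B *\<^sub>v x))"
    by (rule scalar_prod_mult_symmetric[OF centering_mat_symmetric MBx Bx])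
  finally show ?thesis using scalar_prod_self_nonneg by simp
qed

text \<open>Connects the existential \<open>invertible_mat\<close> with the computed
  \<open>mat_inverse\<close>: an invertible matrix is a unit of the matrix ring, so the computation
  does not return \<open>None\<close> and \<open>the\<close> is applied to a genuine
  inverse.\<close>

lemma mat_inv_mult:
  assumes A: "A \<in> carrier_mat n n" and inv: "invertible_mat A"
  shows "mat_inv A \<in> carrier_mat n n" "A * mat_inv A = 1\<^sub>m n" "mat_inv A * A = 1\<^sub>m n"
proof -
  obtain C where AC: "A * C = 1\<^sub>m (dim_row A)" and CA: "C * A = 1\<^sub>m (dim_row C)"
    using inv unfolding invertible_mat_def inverts_mat_def by blast
  \<comment> \<open>The definition of invertibility leaves the dimensions of \<open>C\<close> open;
    comparing columns in the two product equations fixes them.\<close>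
  have "dim_col C = n" "dim_row C = n"
    using arg_cong[OF AC, of dim_col] arg_cong[OF CA, of dim_col] A by auto
  then have C: "C \<in> carrier_mat n n" by auto
  then have "A \<in> Units (ring_mat TYPE(real) n ())"
    using A AC CA unfolding Units_def ring_mat_def by auto
  then obtain D where D: "mat_inverse A = Some D"
    using mat_inverse(1)[OF A, of "()"] by (cases "mat_inverse A") auto
  from mat_inverse(2)[OF A D]
  show "mat_inv A \<in> carrier_mat n n" "A * mat_inv A = 1\<^sub>m n" "mat_inv A * A = 1\<^sub>m n"
    unfolding mat_inv_def D by simp_all
qed

text \<open>The form at an eigenvector for the smallest eigenvalue is nonnegative, so that
  eigenvalue is too; if it were zero, the eigenvector would lie in the kernel of an invertible
  matrix. Positivity is what permits the later divisions.\<close>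

lemma lambda_min_BMB_pos:
  assumes B: "B \<in> carrier_mat n K" and inv: "invertible_mat (BMB n B)" and K: "0 < K"
  shows "0 < lambda_min (BMB n B)"
proof -
  let ?G = "BMB n B"
  note G = BMB_carrier[OF B]
  from lambda_min_in_spectrum[OF BMB_symmetric[OF B] K]
  obtain v where v: "v \<in> carrier_vec K" "v \<noteq> 0\<^sub>v K" "?G *\<^sub>v v = lambda_min ?G \<cdot>\<^sub>v v"
    using G unfolding spectrum_def eigenvalue_def eigenvector_def by auto
  have vv: "0 < v \<bullet> v" using scalar_prod_self_pos v by blast
  have "0 \<le> lambda_min ?G * (v \<bullet> v)" using BMB_psd[OF B v(1)] v by simp
  then have "0 \<le> lambda_min ?G" using vv by (simp add: zero_le_mult_iff)
  moreover have "lambda_min ?G \<noteq> 0"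
  proof
    assume z: "lambda_min ?G = 0"
    have "v = mat_inv ?G *\<^sub>v (?G *\<^sub>v v)"
      using assoc_mult_mat_vec[OF mat_inv_mult(1)[OF G inv] G v(1)] mat_inv_mult(3)[OF G inv] v(1)
      by simp
    also have "?G *\<^sub>v v = 0\<^sub>v K" unfolding v(3) z using v(1) by (intro eq_vecI) auto
    also have "mat_inv ?G *\<^sub>v 0\<^sub>v K = 0\<^sub>v K"
      using mat_inv_mult(1)[OF G inv] by (intro eq_vecI) auto
    finally show False using v(2) by simp
  qed
  ultimately show ?thesis by simp
qed

section \<open>Exposures and length of the portfolio weights\<close>

lemma w_phi_eq:
  assumes B: "B \<in> carrier_mat n K" and inv: "invertible_mat (BMB n B)" and \<phi>: "\<phi> \<in> carrier_vec K"
  shows "w_phi n B \<phi> = centering_mat n *\<^sub>v (B *\<^sub>v (mat_inv (BMB n B) *\<^sub>v \<phi>))"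
  unfolding w_phi_def
  using B \<phi> centering_mat_carrier[of n] mat_inv_mult(1)[OF BMB_carrier[OF B] inv]
  by (simp add: assoc_mult_mat_vec[of _ n K _ K] assoc_mult_mat_vec[of _ n n _ K])

lemma w_phi_carrier:
  assumes "B \<in> carrier_mat n K" "invertible_mat (BMB n B)" "\<phi> \<in> carrier_vec K"
  shows "w_phi n B \<phi> \<in> carrier_vec n"
  unfolding w_phi_eq[OF assms]
  using assms centering_mat_carrier[of n] mat_inv_mult(1)[OF BMB_carrier[OF assms(1)] assms(2)]
  by simp

text \<open>With y = (B'MB)^{-1} phi and w = MBy, w'Bx equals (B'MBy)'x, which is phi'x. The
  portfolio thus has factor exposure exactly phi.\<close>

lemma w_phi_loadings:
  assumes B: "B \<in> carrier_mat n K" and inv: "invertible_mat (BMB n B)" and \<phi>: "\<phi> \<in> carrier_vec K"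
    and x: "x \<in> carrier_vec K"
  shows "w_phi n B \<phi> \<bullet> (B *\<^sub>v x) = \<phi> \<bullet> x"
proof -
  note G = BMB_carrier[OF B]
  have y: "mat_inv (BMB n B) *\<^sub>v \<phi> \<in> carrier_vec K"
    using mat_inv_mult(1)[OF G inv] \<phi> by simp
  show ?thesis unfolding w_phi_eq[OF B inv \<phi>]
    unfolding BMB_form[OF B y x, symmetric]
    using assoc_mult_mat_vec[OF G mat_inv_mult(1)[OF G inv] \<phi>] mat_inv_mult(2)[OF G inv] \<phi>
    by simp
qed

text \<open>M can be moved onto the vector of ones by symmetry, and it annihilates that
  vector.\<close>

lemma w_phi_ones:
  assumes B: "B \<in> carrier_mat n K" and inv: "invertible_mat (BMB n B)" and \<phi>: "\<phi> \<in> carrier_vec K"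
  shows "w_phi n B \<phi> \<bullet> ones_vec n = 0"
proof -
  have By: "B *\<^sub>v (mat_inv (BMB n B) *\<^sub>v \<phi>) \<in> carrier_vec n"
    using B mat_inv_mult(1)[OF BMB_carrier[OF B] inv] \<phi> by simp
  have "ones_vec n \<in> carrier_vec n" unfolding ones_vec_def by simp
  then show ?thesis unfolding w_phi_eq[OF assms]
    using scalar_prod_mult_symmetric[OF centering_mat_symmetric By] centering_mult_ones By
    by simp
qed

lemma w_phi_self_bound:
  assumes B: "B \<in> carrier_mat n K" and inv: "invertible_mat (BMB n B)" and \<phi>: "\<phi> \<in> carrier_vec K"
    and K: "0 < K"
  shows "w_phi n B \<phi> \<bullet> w_phi n B \<phi> \<le> (\<phi> \<bullet> \<phi>) / lambda_min (BMB n B)"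
proof -
  let ?G = "BMB n B" and ?w = "w_phi n B \<phi>"
  define y where "y = mat_inv ?G *\<^sub>v \<phi>"
  note G = BMB_carrier[OF B] and pos = lambda_min_BMB_pos[OF B inv K]
  note w = w_phi_carrier[OF B inv \<phi>]
  have y: "y \<in> carrier_vec K" unfolding y_def using mat_inv_mult(1)[OF G inv] \<phi> by simp
  have By: "B *\<^sub>v y \<in> carrier_vec n" using B y by simp
  have Gy: "?G *\<^sub>v y = \<phi>" unfolding y_def
    using assoc_mult_mat_vec[OF G mat_inv_mult(1)[OF G inv] \<phi>] mat_inv_mult(2)[OF G inv] \<phi>
    by simp
  have wy: "?w = centering_mat n *\<^sub>v (B *\<^sub>v y)" unfolding y_def by (rule w_phi_eq[OF B inv \<phi>])
  have Mw: "centering_mat n *\<^sub>v ?w = ?w" unfolding wy by (rule centering_idempotent[OF By])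
  \<comment> \<open>One factor w is written as MBy; its M is absorbed by the other factor, as Mw =
    w.\<close>
  have "?w \<bullet> ?w = ?w \<bullet> (B *\<^sub>v y)"
    using scalar_prod_mult_symmetric[OF centering_mat_symmetric w By] Mw wy by simp
  then have ww: "?w \<bullet> ?w = \<phi> \<bullet> y" using w_phi_loadings[OF B inv \<phi> y] by simp
  have "lambda_min ?G * (y \<bullet> y) \<le> \<phi> \<bullet> y"
    using lambda_min_le_form[OF BMB_symmetric[OF B] K y] Gy comm_scalar_prod[OF y \<phi>] by simp
  then have "(\<phi> \<bullet> \<phi>) * (lambda_min ?G * (y \<bullet> y)) \<le> (\<phi> \<bullet> \<phi>) * (\<phi> \<bullet> y)"
    by (intro mult_left_mono scalar_prod_self_nonneg)
  moreover have "lambda_min ?G * (\<phi> \<bullet> y)\<^sup>2 \<le> lambda_min ?G * ((\<phi> \<bullet> \<phi>) * (y \<bullet> y))"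
    using vec_Cauchy_Schwarz[OF \<phi> y] pos by (intro mult_left_mono) auto
  \<comment> \<open>Both inequalities share the term lambda_min (phi'phi)(y'y), which eliminates
    y'y.\<close>
  ultimately have *: "(lambda_min ?G * (\<phi> \<bullet> y)) * (\<phi> \<bullet> y) \<le> (\<phi> \<bullet> \<phi>) * (\<phi> \<bullet> y)"
    by (simp add: power2_eq_square mult_ac)
  \<comment> \<open>As phi'y = w'w is nonnegative, it is either zero or a positive factor that can
    be cancelled.\<close>
  have "lambda_min ?G * (\<phi> \<bullet> y) \<le> \<phi> \<bullet> \<phi>"
  proof (cases "\<phi> \<bullet> y = 0")
    case False
    then have "0 < \<phi> \<bullet> y" using ww scalar_prod_self_nonneg[of ?w] by simp
    then show ?thesis using * by simp
  qed (use scalar_prod_self_nonneg[of \<phi>] in simp)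
  then show ?thesis using ww pos by (simp add: field_simps)
qed

section \<open>Moments of linear combinations of the errors\<close>

lemma linear_combination_mean_zero:
  assumes u: "random_vec M n u" and E: "has_expectation_vec M n u (0\<^sub>v n)"
    and w: "w \<in> carrier_vec n"
  shows "integrable M (\<lambda>\<omega>. w \<bullet> u \<omega>)" "(\<integral>\<omega>. w \<bullet> u \<omega> \<partial>M) = 0"
proof -
  \<comment> \<open>The scalar product sums over the dimension of \<open>u \<omega>\<close>, which
    is known to be n only on \<open>space M\<close>.\<close>
  have eq: "w \<bullet> u \<omega> = (\<Sum>i = 0..<n. w $ i * u \<omega> $ i)" if "\<omega> \<in> space M" for \<omega>
    using u that unfolding random_vec_def scalar_prod_def by auto
  have int: "integrable M (\<lambda>\<omega>. u \<omega> $ i)" "(\<integral>\<omega>. u \<omega> $ i \<partial>M) = 0" if "i < n" for i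
    using E that unfolding has_expectation_vec_def by auto
  have "integrable M (\<lambda>\<omega>. \<Sum>i = 0..<n. w $ i * u \<omega> $ i)"
    using int(1) by (intro Bochner_Integration.integrable_sum integrable_mult_right) auto
  then show "integrable M (\<lambda>\<omega>. w \<bullet> u \<omega>)"
    using eq by (subst Bochner_Integration.integrable_cong[OF refl eq]) auto
  have "(\<integral>\<omega>. w \<bullet> u \<omega> \<partial>M) = (\<integral>\<omega>. (\<Sum>i = 0..<n. w $ i * u \<omega> $ i) \<partial>M)"
    by (intro Bochner_Integration.integral_cong refl eq)
  also have "\<dots> = (\<Sum>i = 0..<n. (\<integral>\<omega>. w $ i * u \<omega> $ i \<partial>M))"
    using int(1) by (intro Bochner_Integration.integral_sum integrable_mult_right) auto
  also have "\<dots> = 0" using int by (intro sum.neutral) auto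
  finally show "(\<integral>\<omega>. w \<bullet> u \<omega> \<partial>M) = 0" .
qed

text \<open>The square of w'u is a double sum of w_i w_j u_i u_j, and each u_i u_j is an entry of
  uu' with known expectation, so linearity of the integral suffices.\<close>

lemma linear_combination_second_moment:
  assumes u: "random_vec M n u"
    and E: "has_expectation_mat M n n (\<lambda>\<omega>. outer_prod (u \<omega>) (u \<omega>)) V"
    and w: "w \<in> carrier_vec n"
  shows "integrable M (\<lambda>\<omega>. (w \<bullet> u \<omega>)\<^sup>2)" "(\<integral>\<omega>. (w \<bullet> u \<omega>)\<^sup>2 \<partial>M) = w \<bullet> (V *\<^sub>v w)"
proof -
  let ?o = "\<lambda>\<omega> i j. outer_prod (u \<omega>) (u \<omega>) $$ (i, j)"
  let ?S = "\<lambda>\<omega>. \<Sum>i = 0..<n. \<Sum>j = 0..<n. w $ i * w $ j * ?o \<omega> i j"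
  have V: "V \<in> carrier_mat n n" using E unfolding has_expectation_mat_def by simp
  have eq: "(w \<bullet> u \<omega>)\<^sup>2 = ?S \<omega>" if "\<omega> \<in> space M" for \<omega>
  proof -
    have c: "u \<omega> \<in> carrier_vec n" using u that unfolding random_vec_def by auto
    then have "(w \<bullet> u \<omega>)\<^sup>2 = (\<Sum>i = 0..<n. w $ i * u \<omega> $ i) * (\<Sum>j = 0..<n. w $ j * u \<omega> $ j)"
      unfolding scalar_prod_def power2_eq_square by simp
    then show ?thesis unfolding sum_product using c
      by (auto simp: outer_prod_def mult_ac intro!: sum.cong)
  qed
  have int: "integrable M (\<lambda>\<omega>. ?o \<omega> i j)" "(\<integral>\<omega>. ?o \<omega> i j \<partial>M) = V $$ (i, j)"
    if "i < n" "j < n" for i j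
    using E that unfolding has_expectation_mat_def by auto
  have "integrable M ?S"
    using int(1) by (intro Bochner_Integration.integrable_sum integrable_mult_right) auto
  then show "integrable M (\<lambda>\<omega>. (w \<bullet> u \<omega>)\<^sup>2)"
    by (subst Bochner_Integration.integrable_cong[OF refl eq]) auto
  have "(\<integral>\<omega>. (w \<bullet> u \<omega>)\<^sup>2 \<partial>M) = (\<integral>\<omega>. ?S \<omega> \<partial>M)"
    by (intro Bochner_Integration.integral_cong refl eq)
  also have "\<dots> = (\<Sum>i = 0..<n. \<integral>\<omega>. (\<Sum>j = 0..<n. w $ i * w $ j * ?o \<omega> i j) \<partial>M)"
    using int(1)
    by (intro Bochner_Integration.integral_sum Bochner_Integration.integrable_sum
        integrable_mult_right) auto
  also have "\<dots> = (\<Sum>i = 0..<n. \<Sum>j = 0..<n. (\<integral>\<omega>. w $ i * w $ j * ?o \<omega> i j \<partial>M))"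
    using int(1)
    by (intro sum.cong refl Bochner_Integration.integral_sum integrable_mult_right) auto
  also have "\<dots> = (\<Sum>i = 0..<n. \<Sum>j = 0..<n. w $ i * w $ j * V $$ (i, j))"
    using int(2) by (intro sum.cong refl) auto
  also have "\<dots> = w \<bullet> (V *\<^sub>v w)"
    unfolding scalar_prod_def using V w
    by (auto simp: scalar_prod_def sum_distrib_left mult_ac intro!: sum.cong)
  finally show "(\<integral>\<omega>. (w \<bullet> u \<omega>)\<^sup>2 \<partial>M) = w \<bullet> (V *\<^sub>v w)" .
qed

text \<open>V inherits symmetry from uu', which makes the Rayleigh bounds available for it.\<close>

lemma second_moment_symmetric:
  assumes u: "random_vec M n u"
    and E: "has_expectation_mat M n n (\<lambda>\<omega>. outer_prod (u \<omega>) (u \<omega>)) V"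
  shows "real_symmetric_mat n V"
proof -
  have V: "V \<in> carrier_mat n n" using E unfolding has_expectation_mat_def by simp
  have "V $$ (i, j) = V $$ (j, i)" if "i < n" "j < n" for i j
  proof -
    have "(\<integral>\<omega>. outer_prod (u \<omega>) (u \<omega>) $$ (i, j) \<partial>M) = (\<integral>\<omega>. outer_prod (u \<omega>) (u \<omega>) $$ (j, i) \<partial>M)"
      using u that unfolding random_vec_def outer_prod_def
      by (intro Bochner_Integration.integral_cong refl) auto
    then show ?thesis using E that unfolding has_expectation_mat_def by auto
  qed
  then show ?thesis unfolding real_symmetric_mat_def using V by (auto intro!: eq_matI)
qed

text \<open>The form of V at the first unit vector is the second moment of one error, hence
  nonnegative. The sign is required for multiplying the bound on w'w by
  \<open>lambda_max V\<close>.\<close>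

lemma second_moment_lambda_max_nonneg:
  assumes u: "random_vec M n u"
    and E: "has_expectation_mat M n n (\<lambda>\<omega>. outer_prod (u \<omega>) (u \<omega>)) V" and n: "0 < n"
  shows "0 \<le> lambda_max V"
proof -
  let ?e = "unit_vec n 0 :: rvec"
  have e: "?e \<in> carrier_vec n" by simp
  have "0 \<le> (\<integral>\<omega>. (?e \<bullet> u \<omega>)\<^sup>2 \<partial>M)" by simp
  also have "\<dots> = ?e \<bullet> (V *\<^sub>v ?e)" by (rule linear_combination_second_moment(2)[OF u E e])
  also have "\<dots> \<le> lambda_max V * (?e \<bullet> ?e)"
    by (rule form_le_lambda_max[OF second_moment_symmetric[OF u E] n e])
  finally show ?thesis using n by simp
qed

section \<open>Hedged returns: decomposition, moments and limits\<close>

context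
  fixes M :: "'w measure" and n K :: nat and c :: real and \<phi> \<eta> :: rvec
    and f u r :: "'w \<Rightarrow> rvec" and B V :: rmat
  assumes M: "prob_space M" and K: "1 \<le> K" and \<phi>: "\<phi> \<in> carrier_vec K" and \<phi>_pos: "0 < \<phi> \<bullet> \<phi>"
    and f: "random_vec M K f" and model: "return_model M n K c \<phi> f B \<eta> u V r"
begin

lemma model_parts:
  shows "B \<in> carrier_mat n K" "invertible_mat (BMB n B)" "\<eta> \<in> carrier_vec n"
    and "random_vec M n u" "has_expectation_vec M n u (0\<^sub>v n)"
    and "has_expectation_mat M n n (\<lambda>\<omega>. outer_prod (u \<omega>) (u \<omega>)) V"
    and "\<And>\<omega>. \<omega> \<in> space M \<Longrightarrow> r \<omega> = c \<cdot>\<^sub>v ones_vec n + B *\<^sub>v \<phi> + B *\<^sub>v f \<omega> + \<eta> + u \<omega>"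
  using model unfolding return_model_def by blast+

lemma rho_phi_decomposition:
  assumes \<omega>: "\<omega> \<in> space M"
  shows "rho_phi n B \<phi> r f \<omega> = \<phi> \<bullet> \<phi> + w_phi n B \<phi> \<bullet> \<eta> + w_phi n B \<phi> \<bullet> u \<omega>"
proof -
  note B = model_parts(1) and inv = model_parts(2)
  note w = w_phi_carrier[OF B inv \<phi>]
  have fc: "f \<omega> \<in> carrier_vec K" and uc: "u \<omega> \<in> carrier_vec n"
    using f model_parts(4) \<omega> unfolding random_vec_def by auto
  have one: "ones_vec n \<in> carrier_vec n" unfolding ones_vec_def by simp
  have B\<phi>: "B *\<^sub>v \<phi> \<in> carrier_vec n" and Bf: "B *\<^sub>v f \<omega> \<in> carrier_vec n"
    using B \<phi> fc by simp_all
  \<comment> \<open>The constant drops out since w'1 = 0, the premium term becomes phi'phi, and the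
    factor term becomes phi'f, which the hedge removes.\<close>
  have "w_phi n B \<phi> \<bullet> r \<omega> = c * (w_phi n B \<phi> \<bullet> ones_vec n) + w_phi n B \<phi> \<bullet> (B *\<^sub>v \<phi>)
      + w_phi n B \<phi> \<bullet> (B *\<^sub>v f \<omega>) + w_phi n B \<phi> \<bullet> \<eta> + w_phi n B \<phi> \<bullet> u \<omega>"
    unfolding model_parts(7)[OF \<omega>] using w one B\<phi> Bf model_parts(3) uc
    by (simp add: scalar_prod_add_distrib[of _ n])
  then show ?thesis unfolding rho_phi_def
    using w_phi_ones[OF B inv \<phi>] w_phi_loadings[OF B inv \<phi> \<phi>] w_phi_loadings[OF B inv \<phi> fc]
    by simp
qed

lemma pricing_error_bound:
  "\<bar>w_phi n B \<phi> \<bullet> \<eta>\<bar>\<^sup>2 \<le> (vnorm \<eta>)\<^sup>2 * (vnorm \<phi>)\<^sup>2 / lambda_min (BMB n B)"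
proof -
  note B = model_parts(1) and inv = model_parts(2) and \<eta> = model_parts(3)
  have "(w_phi n B \<phi> \<bullet> \<eta>)\<^sup>2 \<le> (w_phi n B \<phi> \<bullet> w_phi n B \<phi>) * (\<eta> \<bullet> \<eta>)"
    by (rule vec_Cauchy_Schwarz[OF w_phi_carrier[OF B inv \<phi>] \<eta>])
  also have "\<dots> \<le> ((\<phi> \<bullet> \<phi>) / lambda_min (BMB n B)) * (\<eta> \<bullet> \<eta>)"
    using w_phi_self_bound[OF B inv \<phi>] K by (intro mult_right_mono scalar_prod_self_nonneg) simp
  finally show ?thesis by (simp add: vnorm_square mult.commute)
qed

text \<open>The hedged return is a constant plus w'u, whose first two moments exist. This ensures
  that its mean and variance are genuine integrals and not the default value 0 of a non-integrable
  function.\<close>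

lemma rho_phi_integrable:
  "integrable M (rho_phi n B \<phi> r f)" "integrable M (\<lambda>\<omega>. (rho_phi n B \<phi> r f \<omega>)\<^sup>2)"
proof -
  interpret prob_space M by (rule M)
  let ?w = "w_phi n B \<phi>"
  note w = w_phi_carrier[OF model_parts(1,2) \<phi>]
  note int = linear_combination_mean_zero(1)[OF model_parts(4,5) w]
    linear_combination_second_moment(1)[OF model_parts(4,6) w]
  define a where "a = \<phi> \<bullet> \<phi> + ?w \<bullet> \<eta>"
  have eq: "rho_phi n B \<phi> r f \<omega> = a + ?w \<bullet> u \<omega>" if "\<omega> \<in> space M" for \<omega>
    unfolding a_def by (rule rho_phi_decomposition[OF that])
  have "integrable M (\<lambda>\<omega>. a + ?w \<bullet> u \<omega>)" using int(1) by simp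
  then show "integrable M (rho_phi n B \<phi> r f)"
    using Bochner_Integration.integrable_cong[of M M "rho_phi n B \<phi> r f"
        "\<lambda>\<omega>. a + ?w \<bullet> u \<omega>"] eq by blast
  have "integrable M (\<lambda>\<omega>. a\<^sup>2 + 2 * a * (?w \<bullet> u \<omega>) + (?w \<bullet> u \<omega>)\<^sup>2)" using int by simp
  moreover have "(rho_phi n B \<phi> r f \<omega>)\<^sup>2 = a\<^sup>2 + 2 * a * (?w \<bullet> u \<omega>) + (?w \<bullet> u \<omega>)\<^sup>2"
    if "\<omega> \<in> space M" for \<omega>
    unfolding eq[OF that] by (simp add: power2_sum)
  ultimately show "integrable M (\<lambda>\<omega>. (rho_phi n B \<phi> r f \<omega>)\<^sup>2)"
    using Bochner_Integration.integrable_cong[of M M "\<lambda>\<omega>. (rho_phi n B \<phi> r f \<omega>)\<^sup>2"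
        "\<lambda>\<omega>. a\<^sup>2 + 2 * a * (?w \<bullet> u \<omega>) + (?w \<bullet> u \<omega>)\<^sup>2"] by blast
qed

lemma rho_phi_expectation:
  "prob_space.expectation M (rho_phi n B \<phi> r f) = \<phi> \<bullet> \<phi> + w_phi n B \<phi> \<bullet> \<eta>"
proof -
  interpret prob_space M by (rule M)
  note w = w_phi_carrier[OF model_parts(1,2) \<phi>]
  have "expectation (rho_phi n B \<phi> r f)
      = expectation (\<lambda>\<omega>. (\<phi> \<bullet> \<phi> + w_phi n B \<phi> \<bullet> \<eta>) + w_phi n B \<phi> \<bullet> u \<omega>)"
    using rho_phi_decomposition by (intro Bochner_Integration.integral_cong) auto
  also have "\<dots> = \<phi> \<bullet> \<phi> + w_phi n B \<phi> \<bullet> \<eta>"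
    using linear_combination_mean_zero[OF model_parts(4,5) w] by (simp add: prob_space)
  finally show ?thesis .
qed

lemma rho_phi_variance_bound:
  "prob_space.variance M (rho_phi n B \<phi> r f)
    \<le> lambda_max V * (vnorm \<phi>)\<^sup>2 / lambda_min (BMB n B)"
proof -
  let ?w = "w_phi n B \<phi>"
  note B = model_parts(1) and inv = model_parts(2)
  note w = w_phi_carrier[OF B inv \<phi>]
  \<comment> \<open>In dimension zero the product w'B phi would be an empty sum, yet it equals
    phi'phi > 0.\<close>
  have n: "0 < n"
  proof (rule ccontr)
    assume "\<not> 0 < n"
    then have "?w \<bullet> (B *\<^sub>v \<phi>) = 0" using B unfolding scalar_prod_def by simp
    then show False using w_phi_loadings[OF B inv \<phi> \<phi>] \<phi>_pos by simp
  qed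
  \<comment> \<open>Subtracting the mean removes the constant part and leaves exactly w'u.\<close>
  have "prob_space.variance M (rho_phi n B \<phi> r f) = (\<integral>\<omega>. (?w \<bullet> u \<omega>)\<^sup>2 \<partial>M)"
    unfolding rho_phi_expectation
    by (intro Bochner_Integration.integral_cong refl) (simp add: rho_phi_decomposition)
  also have "\<dots> = ?w \<bullet> (V *\<^sub>v ?w)"
    by (rule linear_combination_second_moment(2)[OF model_parts(4,6) w])
  also have "\<dots> \<le> lambda_max V * (?w \<bullet> ?w)"
    by (rule form_le_lambda_max[OF second_moment_symmetric[OF model_parts(4,6)] n w])
  also have "\<dots> \<le> lambda_max V * ((\<phi> \<bullet> \<phi>) / lambda_min (BMB n B))"
    using w_phi_self_bound[OF B inv \<phi>] K second_moment_lambda_max_nonneg[OF model_parts(4,6) n]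
    by (intro mult_left_mono) simp_all
  finally show ?thesis by (simp add: vnorm_square)
qed

end

text \<open>The finite-n claims assume the model at that n alone. The limits assume it only for all
  large n, because invertibility of B'MB excludes small n. Integrability is asserted so that the
  mean and variance have their intended meaning.\<close>

theorem mainTheorem1:
  fixes M :: "'w measure" and K :: nat and c :: real and \<phi> :: rvec
    and f :: "'t \<Rightarrow> 'w \<Rightarrow> rvec"
    and B :: "nat \<Rightarrow> rmat" and \<eta> :: "nat \<Rightarrow> rvec"
    and u :: "nat \<Rightarrow> 't \<Rightarrow> 'w \<Rightarrow> rvec" and V :: "nat \<Rightarrow> rmat"
    and r :: "nat \<Rightarrow> 't \<Rightarrow> 'w \<Rightarrow> rvec" and t :: 't
  assumes "prob_space M"
    and "1 \<le> K"
    and "\<phi> \<in> carrier_vec K" and "0 < \<phi> \<bullet> \<phi>"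
    and "random_vec M K (f t)"
  shows "(\<forall>n. return_model M n K c \<phi> (f t) (B n) (\<eta> n) (u n t) (V n) (r n t) \<longrightarrow>
            (\<forall>\<omega>\<in>space M. rho_phi n (B n) \<phi> (r n t) (f t) \<omega> =
               \<phi> \<bullet> \<phi> + w_phi n (B n) \<phi> \<bullet> \<eta> n + w_phi n (B n) \<phi> \<bullet> u n t \<omega>) \<and>
            \<bar>w_phi n (B n) \<phi> \<bullet> \<eta> n\<bar>\<^sup>2
              \<le> (vnorm (\<eta> n))\<^sup>2 * (vnorm \<phi>)\<^sup>2 / lambda_min (BMB n (B n)) \<and>
            integrable M (rho_phi n (B n) \<phi> (r n t) (f t)) \<and>
            integrable M (\<lambda>\<omega>. (rho_phi n (B n) \<phi> (r n t) (f t) \<omega>)\<^sup>2) \<and>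
            prob_space.variance M (rho_phi n (B n) \<phi> (r n t) (f t))
              \<le> lambda_max (V n) * (vnorm \<phi>)\<^sup>2 / lambda_min (BMB n (B n)))
       \<and> ((\<forall>\<^sub>F n in sequentially.
              return_model M n K c \<phi> (f t) (B n) (\<eta> n) (u n t) (V n) (r n t)) \<longrightarrow>
           (\<lambda>n. (vnorm (\<eta> n))\<^sup>2 / lambda_min (BMB n (B n))) \<longlonglongrightarrow> 0 \<longrightarrow>
           (\<lambda>n. lambda_max (V n) / lambda_min (BMB n (B n))) \<longlonglongrightarrow> 0 \<longrightarrow>
           (\<lambda>n. prob_space.expectation M (rho_phi n (B n) \<phi> (r n t) (f t))) \<longlonglongrightarrow> \<phi> \<bullet> \<phi> \<and>
           (\<lambda>n. prob_space.variance M (rho_phi n (B n) \<phi> (r n t) (f t))) \<longlonglongrightarrow> 0)"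
proof (intro conjI allI impI ballI)
  fix n assume m: "return_model M n K c \<phi> (f t) (B n) (\<eta> n) (u n t) (V n) (r n t)"
  note model = assms(1-5) m
  show "rho_phi n (B n) \<phi> (r n t) (f t) \<omega> =
      \<phi> \<bullet> \<phi> + w_phi n (B n) \<phi> \<bullet> \<eta> n + w_phi n (B n) \<phi> \<bullet> u n t \<omega>" if "\<omega> \<in> space M" for \<omega>
    by (rule rho_phi_decomposition[OF model that])
  show "\<bar>w_phi n (B n) \<phi> \<bullet> \<eta> n\<bar>\<^sup>2
      \<le> (vnorm (\<eta> n))\<^sup>2 * (vnorm \<phi>)\<^sup>2 / lambda_min (BMB n (B n))"
    by (rule pricing_error_bound[OF model])
  show "integrable M (rho_phi n (B n) \<phi> (r n t) (f t))"
    and "integrable M (\<lambda>\<omega>. (rho_phi n (B n) \<phi> (r n t) (f t) \<omega>)\<^sup>2)"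
    by (rule rho_phi_integrable[OF model])+
  show "prob_space.variance M (rho_phi n (B n) \<phi> (r n t) (f t))
      \<le> lambda_max (V n) * (vnorm \<phi>)\<^sup>2 / lambda_min (BMB n (B n))"
    by (rule rho_phi_variance_bound[OF model])
next
  assume ev: "\<forall>\<^sub>F n in sequentially.
      return_model M n K c \<phi> (f t) (B n) (\<eta> n) (u n t) (V n) (r n t)"
    and lim_\<eta>: "(\<lambda>n. (vnorm (\<eta> n))\<^sup>2 / lambda_min (BMB n (B n))) \<longlonglongrightarrow> 0"
    and lim_V: "(\<lambda>n. lambda_max (V n) / lambda_min (BMB n (B n))) \<longlonglongrightarrow> 0"
  \<comment> \<open>The norm of phi does not depend on n, so the pricing error bound is a null
    sequence times a constant.\<close>
  have "(\<lambda>n. \<bar>w_phi n (B n) \<phi> \<bullet> \<eta> n\<bar>\<^sup>2) \<longlonglongrightarrow> 0"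
  proof (rule tendsto_sandwich[where f = "\<lambda>_. 0"])
    show "(\<lambda>n. (vnorm (\<eta> n))\<^sup>2 / lambda_min (BMB n (B n)) * (vnorm \<phi>)\<^sup>2) \<longlonglongrightarrow> 0"
      by (rule tendsto_mult_left_zero[OF lim_\<eta>])
    show "\<forall>\<^sub>F n in sequentially. \<bar>w_phi n (B n) \<phi> \<bullet> \<eta> n\<bar>\<^sup>2
        \<le> (vnorm (\<eta> n))\<^sup>2 / lambda_min (BMB n (B n)) * (vnorm \<phi>)\<^sup>2"
      using ev by eventually_elim (use pricing_error_bound[OF assms(1-5)] in simp)
  qed simp_all
  then have "(\<lambda>n. w_phi n (B n) \<phi> \<bullet> \<eta> n) \<longlonglongrightarrow> 0"
    \<comment> \<open>Continuity of the square root passes from the squared absolute value to the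
      absolute value.\<close>
    using tendsto_real_sqrt by (fastforce simp: tendsto_rabs_zero_iff)
  then have "(\<lambda>n. \<phi> \<bullet> \<phi> + w_phi n (B n) \<phi> \<bullet> \<eta> n) \<longlonglongrightarrow> \<phi> \<bullet> \<phi>"
    using tendsto_add[OF tendsto_const[of "\<phi> \<bullet> \<phi>"]] by fastforce
  moreover have "\<forall>\<^sub>F n in sequentially. \<phi> \<bullet> \<phi> + w_phi n (B n) \<phi> \<bullet> \<eta> n
      = prob_space.expectation M (rho_phi n (B n) \<phi> (r n t) (f t))"
    using ev by eventually_elim (use rho_phi_expectation[OF assms(1-5)] in simp)
  ultimately show "(\<lambda>n. prob_space.expectation M (rho_phi n (B n) \<phi> (r n t) (f t)))
      \<longlonglongrightarrow> \<phi> \<bullet> \<phi>"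
    by (rule Lim_transform_eventually)
  show "(\<lambda>n. prob_space.variance M (rho_phi n (B n) \<phi> (r n t) (f t))) \<longlonglongrightarrow> 0"
  \<comment> \<open>The lower bound 0 holds for every n, as the variance is the integral of a
    square.\<close>
  proof (rule tendsto_sandwich[where f = "\<lambda>_. 0"])
    show "(\<lambda>n. lambda_max (V n) / lambda_min (BMB n (B n)) * (vnorm \<phi>)\<^sup>2) \<longlonglongrightarrow> 0"
      by (rule tendsto_mult_left_zero[OF lim_V])
    show "\<forall>\<^sub>F n in sequentially. prob_space.variance M (rho_phi n (B n) \<phi> (r n t) (f t))
        \<le> lambda_max (V n) / lambda_min (BMB n (B n)) * (vnorm \<phi>)\<^sup>2"
      using ev by eventually_elim (use rho_phi_variance_bound[OF assms(1-5)] in simp)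
  qed simp_all
qed

end
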